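(* Let $\theta\in\mathbb{R}$. If $\theta\in\mathbb{Q}$ then ${}^{\ast}\mathbb{R}_{\varepsilon}(\theta)=0$; otherwise the homomorphism $$\varepsilon(\theta):{}^{\ast}\mathbb{Z}(\theta)\longrightarrow {}^{\ast}\mathbb{R}_{\varepsilon}(\theta),\qquad {}^{\ast}n\mapsto\varepsilon(\theta)({}^{\ast}n),$$ is an isomorphism of groups.
   Context: Fix a non-principal ultrafilter on $\mathbb{N}$; ${}^{\ast}\mathbb{Z}\subset{}^{\ast}\mathbb{R}$ are the corresponding ultrapowers of $\mathbb{Z}$ and $\mathbb{R}$, and ${}^{\ast}\mathbb{R}_{\varepsilon}\subset{}^{\ast}\mathbb{R}$ is the group of infinitesimals (classes of sequences converging to $0$). Write $x\simeq y$ if $x-y\in{}^{\ast}\mathbb{R}_{\varepsilon}$. The group of diophantine approximations of $\theta$ is $${}^{\ast}\mathbb{Z}(\theta)=\{{}^{\ast}n\in{}^{\ast}\mathbb{Z}\mid \exists\,{}^{\ast}n^{\perp}\in{}^{\ast}\mathbb{Z}\text{ with }\theta\,{}^{\ast}n\simeq{}^{\ast}n^{\perp}\};$$ the element ${}^{\ast}n^{\perp}$ is uniquely determined by ${}^{\ast}n$. The error of ${}^{\ast}n\in{}^{\ast}\mathbb{Z}(\theta)$ is $\varepsilon(\theta)({}^{\ast}n)=\theta\,{}^{\ast}n-{}^{\ast}n^{\perp}$, and the error group is ${}^{\ast}\mathbb{R}_{\varepsilon}(\theta)=\{\varepsilon(\theta)({}^{\ast}n)\mid{}^{\ast}n\in{}^{\ast}\mathbb{Z}(\theta)\}\subset{}^{\ast}\mathbb{R}_{\varepsilon}$.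 *)

theory Defs
  imports Complex_Main "HOL-Algebra.Group"
begin

definition nonprincipal_ultrafilter :: "nat filter \<Rightarrow> bool" where
  "nonprincipal_ultrafilter U \<longleftrightarrow>
     U \<noteq> bot \<and>
     (\<forall>P. eventually P U \<or> eventually (\<lambda>n. \<not> P n) U) \<and>
     (\<forall>m. \<not> eventually (\<lambda>n. n = m) U)"

definition ueq :: "nat filter \<Rightarrow> ((nat \<Rightarrow> 'a) \<times> (nat \<Rightarrow> 'a)) set" where
  "ueq U = {(x, y). eventually (\<lambda>n. x n = y n) U}"

definition ultrapower :: "nat filter \<Rightarrow> (nat \<Rightarrow> 'a) set set" where
  "ultrapower U = UNIV // ueq U"

definition uclass :: "nat filter \<Rightarrow> (nat \<Rightarrow> 'a) \<Rightarrow> (nat \<Rightarrow> 'a) set" where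
  "uclass U x = ueq U `` {x}"

(* Functions act on an ultrapower through representatives; the classes united
   below all coincide when X and Y are classes. *)

definition ulift :: "nat filter \<Rightarrow> ('a \<Rightarrow> 'b) \<Rightarrow> (nat \<Rightarrow> 'a) set \<Rightarrow> (nat \<Rightarrow> 'b) set" where
  "ulift U f X = (\<Union>x\<in>X. uclass U (\<lambda>n. f (x n)))"

definition ulift2 ::
  "nat filter \<Rightarrow> ('a \<Rightarrow> 'b \<Rightarrow> 'c) \<Rightarrow> (nat \<Rightarrow> 'a) set \<Rightarrow> (nat \<Rightarrow> 'b) set \<Rightarrow> (nat \<Rightarrow> 'c) set" where
  "ulift2 U f X Y = (\<Union>x\<in>X. \<Union>y\<in>Y. uclass U (\<lambda>n. f (x n) (y n)))"

(* The additive group, in the multiplicative record syntax of HOL-Algebra. *)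

definition ultrapower_group :: "nat filter \<Rightarrow> (nat \<Rightarrow> 'a::ab_group_add) set monoid" where
  "ultrapower_group U =
     \<lparr>carrier = ultrapower U, monoid.mult = ulift2 U (+), one = uclass U (\<lambda>_. 0)\<rparr>"

(* F is the filter along which representatives are required to converge.
   With F = sequentially an infinitesimal is a class having a representative that
   converges to 0 in the ordinary sense; with F = U it is a class smaller in
   absolute value than every positive standard real. The first notion implies
   the second for every nonprincipal ultrafilter U, and the converse holds
   only for some U (the P-points). *)

definition infinitesimals :: "nat filter \<Rightarrow> nat filter \<Rightarrow> (nat \<Rightarrow> real) set set" where
  "infinitesimals U F = {uclass U x | x. (x \<longlongrightarrow> 0) F}"

definition inf_close ::
  "nat filter \<Rightarrow> nat filter \<Rightarrow> (nat \<Rightarrow> real) set \<Rightarrow> (nat \<Rightarrow> real) set \<Rightarrow> bool" where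
  "inf_close U F X Y \<longleftrightarrow> ulift2 U (-) X Y \<in> infinitesimals U F"

(* The ultrapower of the integers is embedded in that of the reals by
   ulift U real_of_int; multiplication by t, precomposed with this embedding,
   is the lift of k |-> t * k. *)

definition is_dual ::
  "nat filter \<Rightarrow> nat filter \<Rightarrow> real \<Rightarrow> (nat \<Rightarrow> int) set \<Rightarrow> (nat \<Rightarrow> int) set \<Rightarrow> bool" where
  "is_dual U F t N M \<longleftrightarrow>
     inf_close U F (ulift U (\<lambda>k. t * real_of_int k) N) (ulift U real_of_int M)"

definition dioph_approx :: "nat filter \<Rightarrow> nat filter \<Rightarrow> real \<Rightarrow> (nat \<Rightarrow> int) set set" where
  "dioph_approx U F t = {N \<in> ultrapower U. \<exists>M \<in> ultrapower U. is_dual U F t N M}"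

definition dual ::
  "nat filter \<Rightarrow> nat filter \<Rightarrow> real \<Rightarrow> (nat \<Rightarrow> int) set \<Rightarrow> (nat \<Rightarrow> int) set" where
  "dual U F t N = (THE M. M \<in> ultrapower U \<and> is_dual U F t N M)"

definition err ::
  "nat filter \<Rightarrow> nat filter \<Rightarrow> real \<Rightarrow> (nat \<Rightarrow> int) set \<Rightarrow> (nat \<Rightarrow> real) set" where
  "err U F t N =
     ulift2 U (-) (ulift U (\<lambda>k. t * real_of_int k) N) (ulift U real_of_int (dual U F t N))"

definition dioph_group :: "nat filter \<Rightarrow> nat filter \<Rightarrow> real \<Rightarrow> (nat \<Rightarrow> int) set monoid" where
  "dioph_group U F t = (ultrapower_group U)\<lparr>carrier := dioph_approx U F t\<rparr>"

definition error_group :: "nat filter \<Rightarrow> nat filter \<Rightarrow> real \<Rightarrow> (nat \<Rightarrow> real) set monoid" where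
  "error_group U F t = (ultrapower_group U)\<lparr>carrier := err U F t ` dioph_approx U F t\<rparr>"

end

theory Submission
  imports Defs
begin

text \<open>
  Everything rests on the discreteness of the integers: an integer sequence that tends to \<open>0\<close>
  along \<open>U\<close> vanishes \<open>U\<close>-almost everywhere (lemma \<open>int_tendsto_0_imp_eventually_0\<close>). Hence two
  duals of the same class, which differ by an integral infinitesimal, are equal
  (\<open>is_dual_unique\<close>), so that the error is a well-defined function. On representatives it is
  \<open>\<theta> * a n - b n\<close>, where \<open>b\<close> represents the dual of \<open>a\<close>. This expression is additive in
  \<open>(a, b)\<close>, and infinitesimals are closed under addition and negation. So the diophantine
  approximations form a subgroup of the ultrapower of \<open>\<int>\<close>, the error is a homomorphism from it
  into the ultrapower of \<open>\<real>\<close>, and the error group is the image.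

  If \<open>\<theta> = p / q\<close>, then \<open>q\<close> times an error is represented by the integers \<open>p * a n - q * b n\<close>; being
  infinitesimal, it is \<open>0\<close>. If \<open>\<theta>\<close> is irrational and \<open>(a, b)\<close>, \<open>(c, d)\<close> give the same error, then
  \<open>\<theta> * (a n - c n)\<close> is the integer \<open>b n - d n\<close> almost everywhere, which forces \<open>a n = c n\<close>; thus
  the error is injective.

  Both choices of the filter \<open>F\<close> satisfy \<open>U \<le> F\<close>, so that a sequence converging along \<open>F\<close>
  converges along \<open>U\<close>, where classes are compared; this treats the two cases at once.
\<close>

section \<open>Classes and their representatives\<close>

lemma uclass_eq: "uclass U x = {y. eventually (\<lambda>n. x n = y n) U}"
  by (auto simp: uclass_def ueq_def)

lemma uclass_eq_iff: "uclass U x = uclass U y \<longleftrightarrow> eventually (\<lambda>n. x n = y n) U"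
proof
  assume "uclass U x = uclass U y"
  moreover have "y \<in> uclass U y" by (simp add: uclass_eq)
  ultimately show "eventually (\<lambda>n. x n = y n) U" by (auto simp: uclass_eq)
next
  assume xy: "eventually (\<lambda>n. x n = y n) U"
  have "eventually (\<lambda>n. x n = z n) U \<longleftrightarrow> eventually (\<lambda>n. y n = z n) U" for z
    by (rule eventually_cong[OF xy]) simp
  then show "uclass U x = uclass U y" by (simp add: uclass_eq)
qed

lemma uclass_eqI: "(\<And>n. x n = y n) \<Longrightarrow> uclass U x = uclass U y"
  by (simp add: uclass_eq)

lemma ultrapower_eq_range: "ultrapower U = range (uclass U)"
  by (auto simp: ultrapower_def uclass_def quotient_def)

lemma uclass_in_ultrapower [simp]: "uclass U x \<in> ultrapower U"
  by (simp add: ultrapower_eq_range)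

lemma ultrapowerE:
  assumes "X \<in> ultrapower U"
  obtains x where "X = uclass U x"
  using assms by (auto simp: ultrapower_eq_range)

lemma ulift_uclass [simp]: "ulift U f (uclass U x) = uclass U (\<lambda>n. f (x n))"
proof -
  have "uclass U (\<lambda>n. f (y n)) = uclass U (\<lambda>n. f (x n))" if "y \<in> uclass U x" for y
    using that unfolding uclass_eq_iff by (auto simp: uclass_eq elim: eventually_mono)
  moreover have "x \<in> uclass U x" by (simp add: uclass_eq)
  ultimately show ?thesis unfolding ulift_def by blast
qed

lemma ulift2_uclass [simp]:
  "ulift2 U f (uclass U x) (uclass U y) = uclass U (\<lambda>n. f (x n) (y n))"
proof -
  have "uclass U (\<lambda>n. f (x' n) (y' n)) = uclass U (\<lambda>n. f (x n) (y n))"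
    if "x' \<in> uclass U x" "y' \<in> uclass U y" for x' y'
  proof -
    have "eventually (\<lambda>n. x n = x' n) U" "eventually (\<lambda>n. y n = y' n) U"
      using that by (simp_all add: uclass_eq)
    then show ?thesis unfolding uclass_eq_iff by eventually_elim simp
  qed
  moreover have "x \<in> uclass U x" "y \<in> uclass U y" by (simp_all add: uclass_eq)
  ultimately show ?thesis unfolding ulift2_def by blast
qed

lemma carrier_ultrapower_group [simp]: "carrier (ultrapower_group U) = ultrapower U"
  and mult_ultrapower_group [simp]: "monoid.mult (ultrapower_group U) = ulift2 U (+)"
  and one_ultrapower_group [simp]: "one (ultrapower_group U) = uclass U (\<lambda>_. 0)"
  by (simp_all add: ultrapower_group_def)

lemma group_ultrapower_group:
  "group (ultrapower_group U :: (nat \<Rightarrow> 'a::ab_group_add) set monoid)"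
proof (rule groupI)
  fix X :: "(nat \<Rightarrow> 'a) set"
  assume "X \<in> carrier (ultrapower_group U)"
  then obtain x where "X = uclass U x" unfolding carrier_ultrapower_group by (rule ultrapowerE)
  then show "\<exists>Y\<in>carrier (ultrapower_group U). Y \<otimes>\<^bsub>ultrapower_group U\<^esub> X = \<one>\<^bsub>ultrapower_group U\<^esub>"
    by (intro bexI[of _ "uclass U (\<lambda>n. - x n)"]) simp_all
qed (auto elim!: ultrapowerE simp: add.assoc)

lemma inv_ultrapower_group:
  "inv\<^bsub>ultrapower_group U\<^esub> (uclass U x) = uclass U (\<lambda>n. - x n)"
  by (rule group.inv_equality[OF group_ultrapower_group]) simp_all

section \<open>Infinitesimals\<close>

lemma uclass_zero_infinitesimal: "uclass U (\<lambda>_. 0) \<in> infinitesimals U F"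
  by (auto simp: infinitesimals_def)

lemma uclass_add_infinitesimal:
  assumes "uclass U x \<in> infinitesimals U F" "uclass U y \<in> infinitesimals U F"
  shows "uclass U (\<lambda>n. x n + y n) \<in> infinitesimals U F"
proof -
  obtain x' y' where x': "uclass U x = uclass U x'" "(x' \<longlongrightarrow> 0) F"
    and y': "uclass U y = uclass U y'" "(y' \<longlongrightarrow> 0) F"
    using assms by (auto simp: infinitesimals_def)
  have "uclass U (\<lambda>n. x n + y n) = uclass U (\<lambda>n. x' n + y' n)"
    using ulift2_uclass[of U "(+)" x y] ulift2_uclass[of U "(+)" x' y'] by (simp only: x'(1) y'(1))
  moreover have "((\<lambda>n. x' n + y' n) \<longlongrightarrow> 0) F"
    using tendsto_add[OF x'(2) y'(2)] by simp
  ultimately show ?thesis unfolding infinitesimals_def by blast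
qed

lemma uclass_uminus_infinitesimal:
  assumes "uclass U x \<in> infinitesimals U F"
  shows "uclass U (\<lambda>n. - x n) \<in> infinitesimals U F"
proof -
  obtain x' where x': "uclass U x = uclass U x'" "(x' \<longlongrightarrow> 0) F"
    using assms by (auto simp: infinitesimals_def)
  have "uclass U (\<lambda>n. - x n) = uclass U (\<lambda>n. - x' n)"
    using ulift_uclass[of U uminus x] ulift_uclass[of U uminus x'] by (simp only: x'(1))
  moreover have "((\<lambda>n. - x' n) \<longlongrightarrow> 0) F"
    using tendsto_minus[OF x'(2)] by simp
  ultimately show ?thesis unfolding infinitesimals_def by blast
qed

text \<open>
  Membership only provides some representative that converges along \<open>F\<close>. By \<open>U \<le> F\<close> it also
  converges along \<open>U\<close>, where limits do not change under modification on a \<open>U\<close>-null set, so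
  convergence along \<open>U\<close> passes to every representative.
\<close>

lemma infinitesimal_tendsto:
  assumes "U \<le> F" "uclass U x \<in> infinitesimals U F"
  shows "(x \<longlongrightarrow> 0) U"
proof -
  obtain y where "uclass U x = uclass U y" and y: "(y \<longlongrightarrow> 0) F"
    using assms(2) by (auto simp: infinitesimals_def)
  then have "eventually (\<lambda>n. x n = y n) U" by (simp add: uclass_eq_iff)
  with tendsto_mono[OF assms(1) y] show ?thesis by (simp add: tendsto_cong)
qed

text \<open>The only integer of absolute value less than \<open>1\<close> is \<open>0\<close>.\<close>

lemma int_tendsto_0_imp_eventually_0:
  fixes k :: "'a \<Rightarrow> int"
  assumes "((\<lambda>n. real_of_int (k n)) \<longlongrightarrow> 0) U"
  shows "eventually (\<lambda>n. k n = 0) U"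
proof -
  have "eventually (\<lambda>n. dist (real_of_int (k n)) 0 < 1) U"
    using assms by (rule tendstoD) simp
  then show ?thesis by eventually_elim simp
qed

section \<open>Diophantine approximations and their errors\<close>

lemma is_dual_uclass:
  "is_dual U F t (uclass U a) (uclass U b) \<longleftrightarrow>
     uclass U (\<lambda>n. t * real_of_int (a n) - real_of_int (b n)) \<in> infinitesimals U F"
  by (simp add: is_dual_def inf_close_def)

text \<open>The difference of the two errors is an integer sequence, and it is infinitesimal.\<close>

lemma is_dual_unique:
  assumes "U \<le> F"
    and "is_dual U F t (uclass U a) (uclass U b)" "is_dual U F t (uclass U a) (uclass U c)"
  shows "uclass U b = uclass U c"
proof -
  let ?e = "\<lambda>b n. t * real_of_int (a n) - real_of_int (b n)"
  have "((\<lambda>n. ?e c n - ?e b n) \<longlongrightarrow> 0 - 0) U"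
    using assms(2,3) unfolding is_dual_uclass
    by (intro tendsto_diff infinitesimal_tendsto[OF assms(1)])
  then have "((\<lambda>n. real_of_int (b n - c n)) \<longlongrightarrow> 0) U" by simp
  then have "eventually (\<lambda>n. b n - c n = 0) U" by (rule int_tendsto_0_imp_eventually_0)
  then show ?thesis by (simp add: uclass_eq_iff)
qed

lemma dioph_approxE:
  assumes "N \<in> dioph_approx U F t"
  obtains a b where "N = uclass U a" "is_dual U F t (uclass U a) (uclass U b)"
proof -
  obtain M where N: "N \<in> ultrapower U" and M: "M \<in> ultrapower U" and NM: "is_dual U F t N M"
    using assms by (auto simp: dioph_approx_def)
  obtain a where a: "N = uclass U a" using N by (rule ultrapowerE)
  obtain b where b: "M = uclass U b" using M by (rule ultrapowerE)
  show thesis using a NM[unfolded a b] by (rule that)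
qed

lemma uclass_in_dioph_approx:
  "is_dual U F t (uclass U a) (uclass U b) \<Longrightarrow> uclass U a \<in> dioph_approx U F t"
  by (auto simp: dioph_approx_def)

text \<open>
  Uniqueness of the dual turns the definite description in the error into a formula that any
  representative of any witnessing class may enter.
\<close>

lemma err_uclass:
  assumes "U \<le> F" "is_dual U F t (uclass U a) (uclass U b)"
  shows "err U F t (uclass U a) = uclass U (\<lambda>n. t * real_of_int (a n) - real_of_int (b n))"
proof -
  have "dual U F t (uclass U a) = uclass U b"
    unfolding dual_def
  proof (rule the_equality)
    fix M assume M: "M \<in> ultrapower U \<and> is_dual U F t (uclass U a) M"
    obtain c where "M = uclass U c" using conjunct1[OF M] by (rule ultrapowerE)
    with M show "M = uclass U b"
      using is_dual_unique[OF assms(1) _ assms(2)] by blast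
  qed (simp add: assms(2))
  then show ?thesis by (simp add: err_def)
qed

lemma is_dual_add:
  assumes "is_dual U F t (uclass U a) (uclass U b)" "is_dual U F t (uclass U c) (uclass U d)"
  shows "is_dual U F t (uclass U (\<lambda>n. a n + c n)) (uclass U (\<lambda>n. b n + d n))"
proof -
  have "t * real_of_int (a n + c n) - real_of_int (b n + d n) =
      (t * real_of_int (a n) - real_of_int (b n)) + (t * real_of_int (c n) - real_of_int (d n))" for n
    by (simp add: algebra_simps)
  then show ?thesis
    using uclass_add_infinitesimal[OF assms[unfolded is_dual_uclass]]
    by (simp only: is_dual_uclass)
qed

lemma is_dual_uminus:
  assumes "is_dual U F t (uclass U a) (uclass U b)"
  shows "is_dual U F t (uclass U (\<lambda>n. - a n)) (uclass U (\<lambda>n. - b n))"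
proof -
  have "t * real_of_int (- a n) - real_of_int (- b n) =
      - (t * real_of_int (a n) - real_of_int (b n))" for n
    by simp
  then show ?thesis
    using uclass_uminus_infinitesimal[OF assms[unfolded is_dual_uclass]]
    by (simp only: is_dual_uclass)
qed

lemma is_dual_zero: "is_dual U F t (uclass U (\<lambda>_. 0)) (uclass U (\<lambda>_. 0))"
  by (simp add: is_dual_uclass uclass_zero_infinitesimal)

lemma subgroup_dioph_approx: "subgroup (dioph_approx U F t) (ultrapower_group U)"
proof
  show "dioph_approx U F t \<subseteq> carrier (ultrapower_group U)"
    by (auto simp: dioph_approx_def)
  show "\<one>\<^bsub>ultrapower_group U\<^esub> \<in> dioph_approx U F t"
    using uclass_in_dioph_approx[OF is_dual_zero] by simp
next
  fix N assume "N \<in> dioph_approx U F t"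
  then obtain a b where N: "N = uclass U a" and ab: "is_dual U F t (uclass U a) (uclass U b)"
    by (rule dioph_approxE)
  show "inv\<^bsub>ultrapower_group U\<^esub> N \<in> dioph_approx U F t"
    using uclass_in_dioph_approx[OF is_dual_uminus[OF ab]] by (simp add: N inv_ultrapower_group)
  fix N' assume "N' \<in> dioph_approx U F t"
  then obtain c d where N': "N' = uclass U c" and cd: "is_dual U F t (uclass U c) (uclass U d)"
    by (rule dioph_approxE)
  show "N \<otimes>\<^bsub>ultrapower_group U\<^esub> N' \<in> dioph_approx U F t"
    using uclass_in_dioph_approx[OF is_dual_add[OF ab cd]] by (simp add: N N')
qed

lemma group_dioph_group: "group (dioph_group U F t)"
  unfolding dioph_group_def
  by (rule subgroup.subgroup_is_group[OF subgroup_dioph_approx group_ultrapower_group])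

lemma carrier_dioph_group [simp]: "carrier (dioph_group U F t) = dioph_approx U F t"
  and mult_dioph_group [simp]: "monoid.mult (dioph_group U F t) = ulift2 U (+)"
  by (simp_all add: dioph_group_def)

lemma carrier_error_group [simp]:
    "carrier (error_group U F t) = err U F t ` dioph_approx U F t"
  and mult_error_group [simp]: "monoid.mult (error_group U F t) = ulift2 U (+)"
  and one_error_group [simp]: "one (error_group U F t) = uclass U (\<lambda>_. 0)"
  by (simp_all add: error_group_def)

lemma err_add:
  assumes "U \<le> F" "N \<in> dioph_approx U F t" "N' \<in> dioph_approx U F t"
  shows "err U F t (ulift2 U (+) N N') = ulift2 U (+) (err U F t N) (err U F t N')"
proof -
  obtain a b where N: "N = uclass U a" and ab: "is_dual U F t (uclass U a) (uclass U b)"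
    using assms(2) by (rule dioph_approxE)
  obtain c d where N': "N' = uclass U c" and cd: "is_dual U F t (uclass U c) (uclass U d)"
    using assms(3) by (rule dioph_approxE)
  show ?thesis
    by (simp add: N N' err_uclass[OF assms(1) ab] err_uclass[OF assms(1) cd]
        err_uclass[OF assms(1) is_dual_add[OF ab cd]])
      (rule uclass_eqI, simp add: algebra_simps)
qed

lemma subgroup_errors:
  assumes "U \<le> F"
  shows "subgroup (err U F t ` dioph_approx U F t) (ultrapower_group U)"
proof -
  have "err U F t N \<in> ultrapower U" if "N \<in> dioph_approx U F t" for N
    using that by (rule dioph_approxE) (simp add: err_uclass[OF assms])
  then have "err U F t \<in> hom (dioph_group U F t) (ultrapower_group U)"
    by (auto simp: hom_def err_add[OF assms])
  then have "group_hom (dioph_group U F t) (ultrapower_group U) (err U F t)"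
    by (simp add: group_hom_def group_hom_axioms_def group_dioph_group group_ultrapower_group)
  then show ?thesis
    using group_hom.img_is_subgroup by fastforce
qed

lemma group_error_group: "U \<le> F \<Longrightarrow> group (error_group U F t)"
  unfolding error_group_def
  by (rule subgroup.subgroup_is_group[OF subgroup_errors group_ultrapower_group])

text \<open>
  If \<open>q\<close> is the denominator of \<open>t\<close>, the sequence representing an error takes its values in the
  discrete group of multiples of \<open>1 / q\<close>, so it tends to \<open>0\<close> only by vanishing almost everywhere.
\<close>

lemma err_rational_eq_0:
  assumes "U \<le> F" "t \<in> \<rat>" "N \<in> dioph_approx U F t"
  shows "err U F t N = uclass U (\<lambda>_. 0)"
proof -
  obtain a b where N: "N = uclass U a" and ab: "is_dual U F t (uclass U a) (uclass U b)"
    using assms(3) by (rule dioph_approxE)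
  obtain p q :: int where q: "q \<noteq> 0" and t: "t = real_of_int p / real_of_int q"
    using Rats_cases'[OF assms(2)] by (metis less_irrefl)
  let ?e = "\<lambda>n. t * real_of_int (a n) - real_of_int (b n)"
  have qe: "real_of_int q * ?e n = real_of_int (p * a n - q * b n)" for n
    using q by (simp add: t field_simps)
  have "(?e \<longlongrightarrow> 0) U"
    using ab by (intro infinitesimal_tendsto[OF assms(1)]) (simp add: is_dual_uclass)
  then have "((\<lambda>n. real_of_int (p * a n - q * b n)) \<longlongrightarrow> 0) U"
    unfolding qe[symmetric] by (rule tendsto_mult_right_zero)
  then have "eventually (\<lambda>n. p * a n - q * b n = 0) U"
    by (rule int_tendsto_0_imp_eventually_0)
  then have "eventually (\<lambda>n. ?e n = 0) U"
  proof eventually_elim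
    case (elim n)
    then show ?case using qe[of n] q by simp
  qed
  then show ?thesis by (simp add: N err_uclass[OF assms(1) ab] uclass_eq_iff)
qed

lemma irrational_mult_int_eq_int:
  assumes "t \<notin> \<rat>" "t * real_of_int k = real_of_int m"
  shows "k = 0"
proof (rule ccontr)
  assume "k \<noteq> 0"
  then have "t = real_of_int m / real_of_int k" using assms(2) by (simp add: field_simps)
  with assms(1) show False by simp
qed

text \<open>
  Two approximations with the same error differ, almost everywhere, by an integer whose
  product with \<open>t\<close> is an integer.
\<close>

lemma inj_on_err_irrational:
  assumes "U \<le> F" "t \<notin> \<rat>"
  shows "inj_on (err U F t) (dioph_approx U F t)"
proof (rule inj_onI)
  fix N N'
  assume NU: "N \<in> dioph_approx U F t" and NU': "N' \<in> dioph_approx U F t"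
    and eq: "err U F t N = err U F t N'"
  obtain a b where N: "N = uclass U a" and ab: "is_dual U F t (uclass U a) (uclass U b)"
    using NU by (rule dioph_approxE)
  obtain c d where N': "N' = uclass U c" and cd: "is_dual U F t (uclass U c) (uclass U d)"
    using NU' by (rule dioph_approxE)
  have "eventually (\<lambda>n. t * real_of_int (a n) - real_of_int (b n) =
      t * real_of_int (c n) - real_of_int (d n)) U"
    using eq by (simp add: N N' err_uclass[OF assms(1) ab] err_uclass[OF assms(1) cd]
        uclass_eq_iff)
  then have "eventually (\<lambda>n. a n = c n) U"
  proof eventually_elim
    case (elim n)
    then have "t * real_of_int (a n - c n) = real_of_int (b n - d n)"
      by (simp add: algebra_simps)
    then show ?case using irrational_mult_int_eq_int[OF assms(2)] by fastforce
  qed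
  then show "N = N'" by (simp add: N N' uclass_eq_iff)
qed

section \<open>The error homomorphism\<close>

text \<open>
  A set that contains all large numbers contains a finite intersection of complements of
  points, and each of these complements belongs to \<open>U\<close>.
\<close>

lemma nonprincipal_ultrafilter_le_sequentially:
  assumes "nonprincipal_ultrafilter U"
  shows "U \<le> sequentially"
proof (rule filter_leI)
  fix P :: "nat \<Rightarrow> bool"
  assume "eventually P sequentially"
  then obtain k where k: "\<And>n. n \<ge> k \<Longrightarrow> P n" by (auto simp: eventually_sequentially)
  have "eventually (\<lambda>n. n \<noteq> m) U" for m
    using assms by (auto simp: nonprincipal_ultrafilter_def)
  then have "eventually (\<lambda>n. \<forall>m\<in>{..<k}. n \<noteq> m) U"
    by (simp add: eventually_ball_finite)
  then show "eventually P U"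
    by eventually_elim (metis k lessThan_iff not_less)
qed

theorem proposition3:
  fixes U F :: "nat filter" and \<theta> :: real
  assumes "nonprincipal_ultrafilter U"
    and "F = sequentially \<or> F = U"
  shows "(\<theta> \<in> \<rat> \<longrightarrow> carrier (error_group U F \<theta>) = {\<one>\<^bsub>error_group U F \<theta>\<^esub>}) \<and>
         (\<theta> \<notin> \<rat> \<longrightarrow> group (dioph_group U F \<theta>) \<and> group (error_group U F \<theta>) \<and>
            err U F \<theta> \<in> iso (dioph_group U F \<theta>) (error_group U F \<theta>))"
proof (intro conjI impI)
  have UF: "U \<le> F"
    using assms nonprincipal_ultrafilter_le_sequentially by auto
  show "group (dioph_group U F \<theta>)" by (rule group_dioph_group)
  show "group (error_group U F \<theta>)" by (rule group_error_group[OF UF])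
  {
    assume "\<theta> \<in> \<rat>"
    moreover have "dioph_approx U F \<theta> \<noteq> {}"
      using uclass_in_dioph_approx[OF is_dual_zero] by blast
    ultimately show "carrier (error_group U F \<theta>) = {\<one>\<^bsub>error_group U F \<theta>\<^esub>}"
      using err_rational_eq_0[OF UF] by auto
  next
    assume "\<theta> \<notin> \<rat>"
    then show "err U F \<theta> \<in> iso (dioph_group U F \<theta>) (error_group U F \<theta>)"
      using inj_on_err_irrational[OF UF]
      by (simp add: iso_def hom_def bij_betw_def err_add[OF UF])
  }
qed

end
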